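(* For every integer $n \geq 0$ and every even integer $k \geq 6$, we have $$b_k(3n+1) \equiv b_k(3n+2) \equiv 0 \pmod{3}.$$
   Context: For an integer $j$ write $\sigma_j(n) := \sum_{d \mid n} d^j$, the sum over positive divisors of $n \ge 1$. For even $k \geq 6$ and integers $n \geq 1$ define $$b_6(n) := \frac{(n^2-n+1)\sigma_1(n) - \sigma_3(n)}{6}, \qquad b_k(n) := \frac{-n^2\sigma_{k-7}(n) + (n^2+1)\sigma_{k-5}(n) - \sigma_{k-3}(n)}{24} \quad (k \geq 8).$$ These numbers are integers for all $n\ge 1$. *)

theory Defs
  imports Complex_Main "HOL-Number_Theory.Cong"
begin

definition divisor_sigma :: "int \<Rightarrow> nat \<Rightarrow> rat" where
  "divisor_sigma j n = (\<Sum>d | d dvd n. of_nat d powi j)"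

text \<open>
  The division is the exact one in the rationals, so no rounding can occur.  Only even \<open>k \<ge> 6\<close>
  and \<open>n \<ge> 1\<close> are meaningful; for them the values are in fact integers.
\<close>

definition b :: "nat \<Rightarrow> nat \<Rightarrow> rat" where
  "b k n =
    (if k = 6 then
       ((of_nat n ^ 2 - of_nat n + 1) * divisor_sigma 1 n - divisor_sigma 3 n) / 6
     else
       (- (of_nat n ^ 2) * divisor_sigma (int k - 7) n
        + (of_nat n ^ 2 + 1) * divisor_sigma (int k - 5) n
        - divisor_sigma (int k - 3) n) / 24)"

end

theory Submission
  imports Defs
begin

text \<open>
  Pairing a divisor \<open>d\<close> of \<open>n\<close> with its cofactor \<open>e = n / d\<close> turns the numerator of \<open>b\<^sub>k(n)\<close>, for
  every even \<open>k \<ge> 6\<close>, into the sum of \<open>d\<^bsup>k-5\<^esup> (d\<^sup>2 - 1) (e\<^sup>2 - 1)\<close>. If \<open>3\<close> does not divide \<open>n\<close>,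
  both brackets are divisible by \<open>3\<close>; moreover \<open>d (d\<^sup>2 - 1)\<close> is even and \<open>d\<^sup>3 (d\<^sup>2 - 1)\<close> is
  divisible by \<open>8\<close>. So each summand is divisible by \<open>18 = 3 \<cdot> 6\<close>, and by \<open>72 = 3 \<cdot> 24\<close> if \<open>k \<ge> 8\<close>.
\<close>

text \<open>Only nonnegative exponents occur below, so the rational divisor sums can be moved into
  the integers, where divisibility arguments apply.\<close>

lemma divisor_sigma_of_nat:
  "divisor_sigma (int j) n = of_int (\<Sum>d | d dvd n. int d ^ j)"
  by (simp add: divisor_sigma_def)

lemma three_dvd_square_minus_one:
  fixes x :: int
  assumes "\<not> 3 dvd x"
  shows "3 dvd x\<^sup>2 - 1"
proof -
  have "x mod 3 = 1 \<or> x mod 3 = 2"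
    using assms by presburger
  then have "3 dvd x - 1 \<or> 3 dvd x + 1"
    by presburger
  then have "3 dvd (x - 1) * (x + 1)"
    by auto
  then show ?thesis
    by (simp add: power2_eq_square algebra_simps)
qed

text \<open>An even \<open>x\<close> yields \<open>8\<close> through its cube; for odd
  \<open>x = 2 * y + 1\<close> the other factor is four times a product of consecutive
  integers.\<close>

lemma eight_dvd_cube_times_square_minus_one:
  fixes x :: int
  shows "8 dvd x ^ 3 * (x\<^sup>2 - 1)"
proof (cases "even x")
  case True
  then have "2 ^ 3 dvd x ^ 3"
    by (rule dvd_power_same)
  then show ?thesis
    by simp
next
  case False
  then obtain y where y: "x = 2 * y + 1"
    by (rule oddE)
  obtain z where z: "y * (y + 1) = 2 * z"
    by (metis dvdE even_mult_iff even_plus_one_iff)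
  have "x\<^sup>2 - 1 = 4 * (y * (y + 1))"
    by (simp add: y power2_eq_square algebra_simps)
  then have "x\<^sup>2 - 1 = 8 * z"
    by (simp add: z)
  then show ?thesis
    by simp
qed

lemma nine_dvd_cofactor_product:
  fixes d e :: int
  assumes "\<not> 3 dvd d * e"
  shows "9 dvd (d\<^sup>2 - 1) * (e\<^sup>2 - 1)"
proof -
  have "3 dvd d\<^sup>2 - 1" "3 dvd e\<^sup>2 - 1"
    using assms by (auto intro!: three_dvd_square_minus_one)
  then have "3 * 3 dvd (d\<^sup>2 - 1) * (e\<^sup>2 - 1)"
    by (rule mult_dvd_mono)
  then show ?thesis
    by simp
qed

lemma eighteen_dvd_summand:
  fixes d e :: int
  assumes "\<not> 3 dvd d * e"
  shows "18 dvd d * (d\<^sup>2 - 1) * (e\<^sup>2 - 1)"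
proof -
  have "9 dvd d * (d\<^sup>2 - 1) * (e\<^sup>2 - 1)"
    using nine_dvd_cofactor_product[OF assms] by (simp add: mult.assoc)
  moreover have "2 dvd d * (d\<^sup>2 - 1) * (e\<^sup>2 - 1)"
    by simp
  ultimately have "9 * 2 dvd d * (d\<^sup>2 - 1) * (e\<^sup>2 - 1)"
    by (rule divides_mult) (simp add: coprime_iff_gcd_eq_1 gcd_non_0_int)
  then show ?thesis
    by simp
qed

text \<open>The exponent is \<open>k - 5\<close> for \<open>k = m + 8\<close>, so a factor
  \<open>d ^ 3\<close> is always available for the divisibility by \<open>8\<close>.\<close>

lemma seventy_two_dvd_summand:
  fixes d e :: int
  assumes "\<not> 3 dvd d * e"
  shows "72 dvd d ^ (m + 3) * (d\<^sup>2 - 1) * (e\<^sup>2 - 1)"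
proof -
  have "9 dvd d ^ (m + 3) * ((d\<^sup>2 - 1) * (e\<^sup>2 - 1))"
    by (rule dvd_mult[OF nine_dvd_cofactor_product[OF assms]])
  moreover have "8 dvd d ^ m * (d ^ 3 * (d\<^sup>2 - 1)) * (e\<^sup>2 - 1)"
    by (rule dvd_mult2[OF dvd_mult[OF eight_dvd_cube_times_square_minus_one]])
  ultimately have "9 dvd d ^ (m + 3) * (d\<^sup>2 - 1) * (e\<^sup>2 - 1)"
      "8 dvd d ^ (m + 3) * (d\<^sup>2 - 1) * (e\<^sup>2 - 1)"
    by (simp_all add: power_add mult_ac)
  then have "9 * 8 dvd d ^ (m + 3) * (d\<^sup>2 - 1) * (e\<^sup>2 - 1)"
    by (rule divides_mult) (simp add: coprime_iff_gcd_eq_1 gcd_non_0_int)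
  then show ?thesis
    by simp
qed

text \<open>Passing to the cofactor is an involution on the divisors of \<open>n\<close>.\<close>

lemma sum_cofactor:
  fixes n :: nat
  assumes "n > 0"
  shows "(\<Sum>d | d dvd n. f (n div d)) = (\<Sum>d | d dvd n. f d)"
  by (rule sum.reindex_bij_witness[of _ "\<lambda>d. n div d" "\<lambda>d. n div d"])
    (use assms in \<open>auto simp: div_div_eq_right\<close>)

text \<open>With \<open>e = n div d\<close>, the mixed term \<open>d * e\<^sup>2\<close> is
  \<open>n * e\<close>, and \<open>e\<close> runs through all divisors again; this produces the
  \<open>- n\<close> in the coefficient of the first divisor sum.\<close>

lemma b_six_eq:
  assumes "n > 0"
  shows "b 6 n =
    of_int (\<Sum>d | d dvd n. int d * ((int d)\<^sup>2 - 1) * ((int (n div d))\<^sup>2 - 1)) / 6"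
proof -
  let ?D = "{d. d dvd n}"
  have "(\<Sum>d\<in>?D. int d * ((int d)\<^sup>2 - 1) * ((int (n div d))\<^sup>2 - 1)) =
      (\<Sum>d\<in>?D. ((int n)\<^sup>2 + 1) * int d - int n * int (n div d) - int d ^ 3)"
  proof (rule sum.cong)
    fix d assume "d \<in> ?D"
    then have n: "int n = int d * int (n div d)"
      by (metis dvd_mult_div_cancel mem_Collect_eq of_nat_mult)
    show "int d * ((int d)\<^sup>2 - 1) * ((int (n div d))\<^sup>2 - 1) =
        ((int n)\<^sup>2 + 1) * int d - int n * int (n div d) - int d ^ 3"
      unfolding n by algebra
  qed simp
  also have "\<dots> = ((int n)\<^sup>2 + 1) * (\<Sum>d\<in>?D. int d)
      - int n * (\<Sum>d\<in>?D. int (n div d)) - (\<Sum>d\<in>?D. int d ^ 3)"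
    by (simp only: sum_subtractf sum_distrib_left)
  also have "\<dots> = ((int n)\<^sup>2 - int n + 1) * (\<Sum>d\<in>?D. int d) - (\<Sum>d\<in>?D. int d ^ 3)"
    using sum_cofactor[OF assms, of int] by (simp add: algebra_simps)
  finally show ?thesis
    using divisor_sigma_of_nat[of 1 n] divisor_sigma_of_nat[of 3 n] by (simp add: b_def)
qed

text \<open>Here the mixed term \<open>d ^ (m + 3) * e\<^sup>2\<close> is
  \<open>n\<^sup>2 * d ^ (m + 1)\<close>, so the formula holds divisor by divisor, without
  reindexing.\<close>

lemma b_ge_eight_eq:
  "b (m + 8) n =
    of_int (\<Sum>d | d dvd n. int d ^ (m + 3) * ((int d)\<^sup>2 - 1) * ((int (n div d))\<^sup>2 - 1)) / 24"
proof -
  let ?D = "{d. d dvd n}"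
  have "(\<Sum>d\<in>?D. int d ^ (m + 3) * ((int d)\<^sup>2 - 1) * ((int (n div d))\<^sup>2 - 1)) =
      (\<Sum>d\<in>?D. - ((int n)\<^sup>2) * int d ^ (m + 1) + ((int n)\<^sup>2 + 1) * int d ^ (m + 3)
        - int d ^ (m + 5))"
  proof (rule sum.cong)
    fix d assume "d \<in> ?D"
    then have n: "int n = int d * int (n div d)"
      by (metis dvd_mult_div_cancel mem_Collect_eq of_nat_mult)
    show "int d ^ (m + 3) * ((int d)\<^sup>2 - 1) * ((int (n div d))\<^sup>2 - 1) =
        - ((int n)\<^sup>2) * int d ^ (m + 1) + ((int n)\<^sup>2 + 1) * int d ^ (m + 3) - int d ^ (m + 5)"
      \<comment> \<open>Splitting the exponents leaves \<open>int d ^ m\<close> as an indeterminate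
        in a polynomial identity.\<close>
      unfolding n power_add by algebra
  qed simp
  also have "\<dots> = - ((int n)\<^sup>2) * (\<Sum>d\<in>?D. int d ^ (m + 1))
      + ((int n)\<^sup>2 + 1) * (\<Sum>d\<in>?D. int d ^ (m + 3)) - (\<Sum>d\<in>?D. int d ^ (m + 5))"
    by (simp only: sum.distrib sum_subtractf sum_distrib_left)
  finally have eq: "(\<Sum>d\<in>?D. int d ^ (m + 3) * ((int d)\<^sup>2 - 1) * ((int (n div d))\<^sup>2 - 1)) = \<dots>" .
  have exps: "int (m + 8) - 7 = int (m + 1)" "int (m + 8) - 5 = int (m + 3)"
      "int (m + 8) - 3 = int (m + 5)"
    by simp_all
  show ?thesis
    unfolding eq b_def exps divisor_sigma_of_nat by simp
qed

text \<open>The existential form records integrality of the rational value along with divisibility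
  by 3.\<close>

lemma b_multiple_of_three:
  assumes "even k" "k \<ge> 6" "\<not> 3 dvd n"
  shows "\<exists>u. b k n = of_int (3 * u)"
proof -
  have cofactor: "\<not> 3 dvd int d * int (n div d)" if "d dvd n" for d
    using assms(3) that int_dvd_int_iff[of 3 n] by (simp flip: of_nat_mult)
  show ?thesis
  proof (cases "k = 6")
    case True
    have "18 dvd (\<Sum>d | d dvd n. int d * ((int d)\<^sup>2 - 1) * ((int (n div d))\<^sup>2 - 1))"
      using cofactor by (intro dvd_sum eighteen_dvd_summand) auto
    then obtain u where
      "(\<Sum>d | d dvd n. int d * ((int d)\<^sup>2 - 1) * ((int (n div d))\<^sup>2 - 1)) = 18 * u"
      by (rule dvdE)
    moreover have "n > 0"
      using assms(3) by (intro Nat.gr0I) simp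
    ultimately have "b k n = of_int (3 * u)"
      unfolding True by (simp only: b_six_eq)
    then show ?thesis ..
  next
    case False
    \<comment> \<open>Evenness rules out \<open>k = 7\<close>.\<close>
    with assms(1,2) have "k \<ge> 8"
      by presburger
    then obtain m where k: "k = m + 8"
      by (metis add.commute le_Suc_ex)
    have "72 dvd (\<Sum>d | d dvd n.
        int d ^ (m + 3) * ((int d)\<^sup>2 - 1) * ((int (n div d))\<^sup>2 - 1))"
      using cofactor by (intro dvd_sum seventy_two_dvd_summand) auto
    then obtain u where
      "(\<Sum>d | d dvd n. int d ^ (m + 3) * ((int d)\<^sup>2 - 1) * ((int (n div d))\<^sup>2 - 1)) = 72 * u"
      by (rule dvdE)
    then have "b k n = of_int (3 * u)"
      unfolding k b_ge_eight_eq by simp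
    then show ?thesis ..
  qed
qed

theorem theorem2p1:
  fixes n k :: nat
  assumes "even k" and "k \<ge> 6"
  shows "\<exists>u v :: int. b k (3 * n + 1) = of_int u \<and> b k (3 * n + 2) = of_int v \<and>
           [u = v] (mod 3) \<and> [v = 0] (mod 3)"
proof -
  have "\<not> 3 dvd 3 * n + 1" "\<not> 3 dvd 3 * n + 2"
    by presburger+
  then obtain u v where "b k (3 * n + 1) = of_int (3 * u)" "b k (3 * n + 2) = of_int (3 * v)"
    using b_multiple_of_three[OF assms] by meson
  moreover have "[3 * u = 3 * v] (mod 3)" "[3 * v = 0] (mod 3)"
    by (simp_all add: cong_def)
  ultimately show ?thesis
    by blast
qed

end
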